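(* Assume that $z,w\in A_1$, $[z,w]=1$, and $z$ is conjugate to some element in $D_{\ge 0}$ (or in $D_{\le 0}$). Then $z$ and $w$ generate $A_1$ (as a $K$-algebra).
   Context: $K$ is a field of characteristic $0$. $A_1$ is the first Weyl algebra over $K$, i.e. the associative unital $K$-algebra generated by $p,q$ subject to $pq-qp=1$; the elements $p^iq^j$ ($i,j\in\mathbb{Z}_{\ge0}$) form a $K$-basis. $[a,b]=ab-ba$. For $t\in\mathbb{Z}$, $D_t=\mathrm{Span}_K\{p^iq^s : i,s\ge 0,\ s-i=t\}$; $D_{\ge 0}=\bigoplus_{t\ge 0}D_t$ and $D_{\le 0}=\bigoplus_{t\le 0}D_t$. Elements $z_1,z_2\in A_1$ are called conjugate if $\psi(z_1)=z_2$ for some $K$-algebra automorphism $\psi\in\mathrm{Aut}(A_1)$. *)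

theory Defs
  imports
    Complex_Main
    "HOL-Library.Poly_Mapping"
    "HOL-Computational_Algebra.Polynomial"
begin

section \<open>The free algebra on two generators\<close>

text \<open>
  The free algebra \<open>K\<langle>p,q\<rangle>\<close> is the monoid algebra over \<open>K\<close> of the free monoid on \<open>{p,q}\<close>. The
  multiplication of \<^type>\<open>poly_mapping\<close> is the convolution product for the additively written
  monoid of keys, so concatenation of words is written \<open>+\<close> (which is not commutative here).
\<close>

datatype gen = GenP | GenQ

datatype gen_word = Word (letters: "gen list")

instantiation gen_word :: monoid_add
begin

definition "0 = Word []"

definition "u + v = Word (letters u @ letters v)"

instance
  by standard (simp_all add: zero_gen_word_def plus_gen_word_def)

end

type_synonym 'k free_alg = "gen_word \<Rightarrow>\<^sub>0 'k"

definition free_gen :: "gen \<Rightarrow> 'k::field free_alg" where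
  "free_gen g = Poly_Mapping.single (Word [g]) 1"

definition free_const :: "'k \<Rightarrow> 'k::field free_alg" where
  "free_const c = Poly_Mapping.single 0 c"

lemma free_alg_induct [case_names zero add]:
  fixes f :: "'k::field free_alg"
  assumes "P 0" and "\<And>f w c. P f \<Longrightarrow> P (f + Poly_Mapping.single w c)"
  shows "P f"
proof (induction f rule: update_induct)
  case const
  show ?case using assms(1) by simp
next
  case (update f a b)
  have "Poly_Mapping.update a b f = f + Poly_Mapping.single a b"
    using update.hyps
    by (intro poly_mapping_eqI)
      (auto simp: lookup_update lookup_add lookup_single when_def in_keys_iff)
  then show ?case
    using assms(2) update.IH by simp
qed

lemma free_const_commute: "free_const c * f = f * free_const c"
  by (induction f rule: free_alg_induct)
    (simp_all add: distrib_left distrib_right free_const_def mult_single mult.commute)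

definition two_sided_ideal :: "'a::ring_1 set \<Rightarrow> bool" where
  "two_sided_ideal I \<longleftrightarrow>
     0 \<in> I \<and> (\<forall>a\<in>I. \<forall>b\<in>I. a + b \<in> I) \<and> (\<forall>a\<in>I. \<forall>r. r * a \<in> I \<and> a * r \<in> I)"

definition weyl_ideal :: "'k::field free_alg set" where
  "weyl_ideal = two_sided_ideal hull
     {free_gen GenP * free_gen GenQ - free_gen GenQ * free_gen GenP - 1}"

lemma two_sided_ideal_weyl_ideal: "two_sided_ideal weyl_ideal"
  unfolding weyl_ideal_def
  by (rule hull_in) (auto simp: two_sided_ideal_def)

lemma weyl_ideal_0: "0 \<in> weyl_ideal"
  and weyl_ideal_add: "a \<in> weyl_ideal \<Longrightarrow> b \<in> weyl_ideal \<Longrightarrow> a + b \<in> weyl_ideal"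
  and weyl_ideal_mult_left: "a \<in> weyl_ideal \<Longrightarrow> r * a \<in> weyl_ideal"
  and weyl_ideal_mult_right: "a \<in> weyl_ideal \<Longrightarrow> a * r \<in> weyl_ideal"
  using two_sided_ideal_weyl_ideal unfolding two_sided_ideal_def by blast+

lemma weyl_ideal_uminus: "a \<in> weyl_ideal \<Longrightarrow> - a \<in> weyl_ideal"
  using weyl_ideal_mult_left[of a "- 1"] by simp

section \<open>The action on polynomials\<close>

text \<open>
  The free algebra acts on \<open>K[x]\<close> with \<open>p\<close> as \<open>d/dx\<close> and \<open>q\<close> as multiplication by \<open>x\<close>. This is only
  used to see that the ideal is proper, as \<^class>\<open>ring_1\<close> requires \<open>0 \<noteq> 1\<close>.
\<close>

fun gen_act :: "gen \<Rightarrow> 'k::field poly \<Rightarrow> 'k poly" where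
  "gen_act GenP v = pderiv v"
| "gen_act GenQ v = pCons 0 v"

definition word_act :: "gen_word \<Rightarrow> 'k::field poly \<Rightarrow> 'k poly" where
  "word_act w v = foldr gen_act (letters w) v"

definition free_act :: "'k::field free_alg \<Rightarrow> 'k poly \<Rightarrow> 'k poly" where
  "free_act f v = (\<Sum>w\<in>Poly_Mapping.keys f. smult (Poly_Mapping.lookup f w) (word_act w v))"

lemma gen_act_linear:
  "gen_act g (u + v) = gen_act g u + gen_act g v"
  "gen_act g (smult c v) = smult c (gen_act g v)"
  by (cases g; simp add: pderiv_add pderiv_smult)+

lemma word_act_linear:
  "word_act w (u + v) = word_act w u + word_act w v"
  "word_act w (smult c v) = smult c (word_act w v)"
proof -
  have "foldr gen_act l (u + v) = foldr gen_act l u + foldr gen_act l v"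
    and "foldr gen_act l (smult c v) = smult c (foldr gen_act l v)" for l
    by (induction l) (simp_all add: gen_act_linear)
  then show "word_act w (u + v) = word_act w u + word_act w v"
    "word_act w (smult c v) = smult c (word_act w v)"
    by (simp_all add: word_act_def)
qed

lemma word_act_0 [simp]: "word_act w 0 = 0"
  using word_act_linear(2)[of w 0 0] by simp

lemma word_act_add_word: "word_act (u + w) v = word_act u (word_act w v)"
  by (simp add: word_act_def plus_gen_word_def)

lemma free_act_0_left [simp]: "free_act 0 v = 0"
  by (simp add: free_act_def)

lemma free_act_single: "free_act (Poly_Mapping.single w c) v = smult c (word_act w v)"
  by (simp add: free_act_def)

lemma free_act_add_left: "free_act (f + g) v = free_act f v + free_act g v"
  unfolding free_act_def
  by (rule setsum_keys_plus_distrib) (simp_all add: smult_add_left)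

lemma free_act_linear_right:
  "free_act f (u + v) = free_act f u + free_act f v"
  "free_act f (smult c v) = smult c (free_act f v)"
proof -
  have "smult c (sum h A) = (\<Sum>a\<in>A. smult c (h a))" for h :: "gen_word \<Rightarrow> 'a poly" and A
    by (induction A rule: infinite_finite_induct) (simp_all add: smult_add_right)
  then show "free_act f (smult c v) = smult c (free_act f v)"
    by (simp add: free_act_def word_act_linear mult.commute)
qed (simp add: free_act_def word_act_linear smult_add_right sum.distrib)

lemma free_act_mult: "free_act (f * g) v = free_act f (free_act g v)"
proof (induction f rule: free_alg_induct)
  case zero
  show ?case by simp
next
  case (add f w c)
  have "free_act (Poly_Mapping.single w c * g) v = smult c (word_act w (free_act g v))"
  proof (induction g rule: free_alg_induct)
    case zero
    show ?case by simp
  next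
    case (add g w' c')
    then show ?case
      by (simp add: distrib_left free_act_add_left mult_single free_act_single
          word_act_linear word_act_add_word smult_add_right)
  qed
  with add show ?case
    by (simp add: distrib_right free_act_add_left free_act_single)
qed

lemma free_act_1 [simp]: "free_act 1 v = v"
  by (simp add: free_act_single word_act_def zero_gen_word_def flip: single_one)

lemma free_act_uminus_left: "free_act (- f) v = - free_act f v"
  using free_act_add_left[of f "- f" v] by (simp add: add_eq_0_iff)

lemma free_act_weyl_ideal:
  assumes "f \<in> weyl_ideal"
  shows "free_act f v = 0"
proof -
  let ?J = "{f. \<forall>v. free_act f v = 0} :: 'a free_alg set"
  have "free_act f 0 = 0" for f :: "'a free_alg"
    using free_act_linear_right(2)[of f 0 0] by simp
  then have "two_sided_ideal ?J"
    by (simp add: two_sided_ideal_def free_act_add_left free_act_mult)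
  moreover have
    "free_gen GenP * free_gen GenQ - free_gen GenQ * free_gen GenP - 1 \<in> ?J"
    by (simp add: diff_conv_add_uminus free_act_add_left free_act_uminus_left free_act_mult
        free_gen_def free_act_single word_act_def pderiv_pCons
        del: add_uminus_conv_diff)
  ultimately have "weyl_ideal \<subseteq> ?J"
    unfolding weyl_ideal_def by (intro hull_minimal) auto
  with assms show ?thesis by auto
qed

lemma one_notin_weyl_ideal: "1 \<notin> weyl_ideal"
  using free_act_weyl_ideal[of 1 1] by auto

section \<open>The first Weyl algebra\<close>

definition weyl_rel :: "'k::field free_alg \<Rightarrow> 'k free_alg \<Rightarrow> bool" where
  "weyl_rel f g \<longleftrightarrow> f - g \<in> weyl_ideal"

quotient_type (overloaded) 'k weyl = "'k::field free_alg" / weyl_rel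
proof (rule equivpI)
  show "reflp weyl_rel"
    by (simp add: reflp_def weyl_rel_def weyl_ideal_0)
  show "symp weyl_rel"
    unfolding symp_def weyl_rel_def by (metis minus_diff_eq weyl_ideal_uminus)
  show "transp weyl_rel"
    unfolding transp_def weyl_rel_def
    by (metis (no_types, lifting) add_diff_eq diff_add_cancel weyl_ideal_add)
qed

instantiation weyl :: (field) ring_1
begin

lift_definition zero_weyl :: "'a weyl" is 0 .

lift_definition one_weyl :: "'a weyl" is 1 .

lift_definition plus_weyl :: "'a weyl \<Rightarrow> 'a weyl \<Rightarrow> 'a weyl" is "(+)"
  unfolding weyl_rel_def by (metis add_diff_add weyl_ideal_add)

lift_definition uminus_weyl :: "'a weyl \<Rightarrow> 'a weyl" is uminus
  unfolding weyl_rel_def by (metis minus_diff_minus weyl_ideal_uminus)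

lift_definition minus_weyl :: "'a weyl \<Rightarrow> 'a weyl \<Rightarrow> 'a weyl" is "(-)"
proof -
  fix a b c d :: "'a free_alg"
  assume "weyl_rel a b" "weyl_rel c d"
  then have "(a - b) + - (c - d) \<in> weyl_ideal"
    unfolding weyl_rel_def by (intro weyl_ideal_add weyl_ideal_uminus)
  then show "weyl_rel (a - c) (b - d)"
    by (simp add: weyl_rel_def algebra_simps)
qed

lift_definition times_weyl :: "'a weyl \<Rightarrow> 'a weyl \<Rightarrow> 'a weyl" is "(*)"
proof -
  fix a b c d :: "'a free_alg"
  assume "weyl_rel a b" "weyl_rel c d"
  then have "(a - b) * c + b * (c - d) \<in> weyl_ideal"
    unfolding weyl_rel_def
    by (intro weyl_ideal_add weyl_ideal_mult_left weyl_ideal_mult_right)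
  then show "weyl_rel (a * c) (b * d)"
    by (simp add: weyl_rel_def algebra_simps)
qed

instance
proof
  show "(0 :: 'a weyl) \<noteq> 1"
    by transfer (use weyl_ideal_uminus one_notin_weyl_ideal in \<open>fastforce simp: weyl_rel_def\<close>)
qed (transfer; simp add: weyl_rel_def weyl_ideal_0 algebra_simps)+

end

lift_definition weyl_scale :: "'k \<Rightarrow> 'k::field weyl \<Rightarrow> 'k weyl" (infixr \<open>*\<^sub>K\<close> 75)
  is "\<lambda>c f. free_const c * f"
  unfolding weyl_rel_def by (metis right_diff_distrib weyl_ideal_mult_left)

lift_definition weyl_p :: "'k::field weyl" is "free_gen GenP" .

lift_definition weyl_q :: "'k::field weyl" is "free_gen GenQ" .

global_interpretation weyl: vector_space "weyl_scale :: 'k::field \<Rightarrow> 'k weyl \<Rightarrow> 'k weyl"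
proof
  fix a b :: 'k and x y :: "'k weyl"
  show "a *\<^sub>K (x + y) = a *\<^sub>K x + a *\<^sub>K y"
    by transfer (simp add: weyl_rel_def weyl_ideal_0 distrib_left)
  show "(a + b) *\<^sub>K x = a *\<^sub>K x + b *\<^sub>K x"
    by transfer (simp add: weyl_rel_def weyl_ideal_0 distrib_right free_const_def single_add)
  show "a *\<^sub>K b *\<^sub>K x = (a * b) *\<^sub>K x"
    by transfer
      (simp add: weyl_rel_def weyl_ideal_0 free_const_def mult_single flip: mult.assoc)
  show "1 *\<^sub>K x = x"
    by transfer (simp add: weyl_rel_def weyl_ideal_0 free_const_def)
qed

lemma weyl_scale_mult_left: "(c *\<^sub>K x) * y = c *\<^sub>K (x * y)"
  by transfer (simp add: weyl_rel_def weyl_ideal_0 mult.assoc)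

lemma weyl_scale_mult_right: "x * (c *\<^sub>K y) = c *\<^sub>K (x * y)"
  by transfer
    (simp add: weyl_rel_def weyl_ideal_0 free_const_commute flip: mult.assoc,
     simp add: weyl_ideal_0 mult.assoc free_const_commute)

lemma weyl_commutation: "weyl_p * weyl_q - weyl_q * weyl_p = 1"
  by transfer (simp add: weyl_rel_def weyl_ideal_def hull_inc)

section \<open>Grading, conjugacy and generated subalgebras\<close>

definition commutator :: "'a::ring \<Rightarrow> 'a \<Rightarrow> 'a" where
  "commutator a b = a * b - b * a"

definition weyl_D :: "int \<Rightarrow> 'k::field weyl set" where
  "weyl_D t = weyl.span {weyl_p ^ i * weyl_q ^ s | i s :: nat. int s - int i = t}"

text \<open>
  The internal direct sums of the \<open>D\<^sub>t\<close>; as a set, such a sum is the span of the union of the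
  summands.
\<close>

definition weyl_D_nonneg :: "'k::field weyl set" where
  "weyl_D_nonneg = weyl.span (\<Union>t\<in>{0..}. weyl_D t)"

definition weyl_D_nonpos :: "'k::field weyl set" where
  "weyl_D_nonpos = weyl.span (\<Union>t\<in>{..0}. weyl_D t)"

definition weyl_automorphism :: "('k::field weyl \<Rightarrow> 'k weyl) \<Rightarrow> bool" where
  "weyl_automorphism \<psi> \<longleftrightarrow>
     bij \<psi> \<and> Vector_Spaces.linear weyl_scale weyl_scale \<psi> \<and>
     \<psi> 1 = 1 \<and> (\<forall>x y. \<psi> (x * y) = \<psi> x * \<psi> y)"

definition weyl_conjugate :: "'k::field weyl \<Rightarrow> 'k weyl \<Rightarrow> bool" where
  "weyl_conjugate z1 z2 \<longleftrightarrow> (\<exists>\<psi>. weyl_automorphism \<psi> \<and> \<psi> z1 = z2)"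

definition weyl_subalgebra :: "'k::field weyl set \<Rightarrow> bool" where
  "weyl_subalgebra B \<longleftrightarrow> weyl.subspace B \<and> 1 \<in> B \<and> (\<forall>x\<in>B. \<forall>y\<in>B. x * y \<in> B)"

definition weyl_generated :: "'k::field weyl set \<Rightarrow> 'k weyl set" where
  "weyl_generated S = weyl_subalgebra hull S"

end

theory Submission
  imports Defs
begin

text \<open>
  An automorphism carries the pair \<open>z, w\<close> to another pair with commutator \<open>1\<close> and generated
  subalgebras to generated subalgebras, so \<open>z\<close> itself may be taken in the sum of the \<open>D\<^sub>t\<close> with
  \<open>t \<ge> 0\<close>, or in the sum of those with \<open>t \<le> 0\<close>. What follows then is an argument on Newton polygons.
  Expand elements in the basis of the \<open>q\<^sup>s p\<^sup>i\<close>, with exponent \<open>(i, s)\<close>, and let the support be the set of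
  exponents that occur.

  If exponents are compared by a weight \<open>\<sigma> i + \<rho> s\<close> with \<open>\<sigma> + \<rho> \<ge> 0\<close>, ties being broken by \<open>i + s\<close>,
  then reordering a product only produces smaller exponents. Hence, if the leading exponents
  \<open>(i, s)\<close> of \<open>z\<close> and \<open>(j, t)\<close> of \<open>w\<close> satisfy \<open>i t \<noteq> s j\<close>, the commutator has a nonzero term at
  \<open>(i + j - 1, s + t - 1)\<close>, as a Poisson bracket would (\<open>qp_coeff_commutator_leading\<close>). When the
  commutator is \<open>1\<close>, leading exponents are therefore parallel or satisfy \<open>i + j = s + t = 1\<close>. This
  property of the two supports is called \<open>unit_bracket\<close>, and from there on only plane
  geometry is needed.

  Let the support of \<open>z\<close> lie in \<open>i \<le> s\<close>, and remove the constant term of \<open>z\<close>. The sum of the \<open>D\<^sub>t\<close>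
  with \<open>t \<ge> 0\<close> acts on the one-dimensional space \<open>K[x]/(x)\<close>, where commutators vanish, so \<open>w\<close> has an exponent
  with \<open>j > t\<close>. Three choices of weight then pin down both elements.

  \<^item> With \<open>(\<sigma>, \<rho>) = (1, -1)\<close> the leading exponents cannot be parallel, so they are those of \<open>q\<close>
  and \<open>p\<close> (\<open>unit_bracket_first_edge\<close>).

  \<^item> Rotate the weight from \<open>(1, -1)\<close> towards \<open>(1, 0)\<close>. At the first direction \<open>(1, -\<theta>)\<close> in which a new
  exponent reaches the top weight, the new leading exponents would still be
  neither parallel nor of sum \<open>(1, 1)\<close>. So no such direction exists: \<open>z\<close> is a polynomial in \<open>q\<close>, and
  \<open>w\<close> has degree at most one in \<open>p\<close> (\<open>unit_bracket_no_second_edge\<close>).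

  \<^item> With a weight that makes \<open>p\<close> dominate, \<open>z\<close> is seen to be linear in \<open>q\<close> and the coefficient
  of \<open>p\<close> in \<open>w\<close> to be a constant (\<open>unit_bracket_last_edge\<close>).

  So \<open>z = \<alpha> q + \<gamma>\<close> and \<open>w = \<beta> p + h(q)\<close> with \<open>\<alpha>\<close> and \<open>\<beta>\<close> nonzero, and these two generate. The property
  \<open>unit_bracket\<close> is symmetric under exchanging the two coordinates, which gives the case \<open>s \<le> i\<close>,
  with the invariant line \<open>K \<cdot> 1\<close> of \<open>K[x]\<close> in place of the quotient \<open>K[x]/(x)\<close>.
\<close>

section \<open>The representation on polynomials\<close>

lift_definition weyl_act :: "'k::field weyl \<Rightarrow> 'k poly \<Rightarrow> 'k poly" is free_act
proof
  fix f g :: "'k free_alg" and v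
  assume "weyl_rel f g"
  then have "free_act (f - g) v = 0"
    by (simp add: weyl_rel_def free_act_weyl_ideal)
  then show "free_act f v = free_act g v"
    by (metis diff_add_cancel free_act_add_left add_0)
qed

lemma weyl_act_add: "weyl_act (a + b) v = weyl_act a v + weyl_act b v"
  by transfer (rule free_act_add_left)

lemma weyl_act_zero [simp]: "weyl_act 0 v = 0"
  by transfer simp

lemma weyl_act_one [simp]: "weyl_act 1 v = v"
  by transfer simp

lemma weyl_act_uminus: "weyl_act (- a) v = - weyl_act a v"
  by transfer (rule free_act_uminus_left)

lemma weyl_act_diff: "weyl_act (a - b) v = weyl_act a v - weyl_act b v"
  using weyl_act_add[of a "- b" v] by (simp add: weyl_act_uminus)

lemma weyl_act_mult: "weyl_act (a * b) v = weyl_act a (weyl_act b v)"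
  by transfer (rule free_act_mult)

lemma weyl_act_scale: "weyl_act (c *\<^sub>K a) v = smult c (weyl_act a v)"
  by transfer (simp add: free_act_mult free_const_def free_act_single word_act_def zero_gen_word_def)

lemma weyl_act_sum: "weyl_act (sum f A) v = (\<Sum>x\<in>A. weyl_act (f x) v)"
  by (induction A rule: infinite_finite_induct) (simp_all add: weyl_act_add)

lemma weyl_act_smult: "weyl_act a (smult c v) = smult c (weyl_act a v)"
  by transfer (rule free_act_linear_right)

lemma weyl_act_p: "weyl_act weyl_p v = pderiv v"
  by transfer (simp add: free_gen_def free_act_single word_act_def)

lemma weyl_act_q: "weyl_act weyl_q v = pCons 0 v"
  by transfer (simp add: free_gen_def free_act_single word_act_def)

lemma weyl_act_p_power: "weyl_act (weyl_p ^ i) v = (pderiv ^^ i) v"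
  by (induction i) (simp_all add: weyl_act_mult weyl_act_p)

lemma weyl_act_q_power: "weyl_act (weyl_q ^ s) v = monom 1 s * v"
  by (induction s) (simp_all add: weyl_act_mult weyl_act_q monom_Suc)

section \<open>The basis of normally ordered monomials\<close>

text \<open>
  Powers of \<open>q\<close> stand on the left, although the grading is stated with those of \<open>p\<close> on the left: in this
  order a monomial with \<open>i > n\<close> annihilates \<open>x\<^sup>n\<close>, which makes linear independence
  triangular.
\<close>

definition qp_mon :: "nat \<times> nat \<Rightarrow> 'k::field weyl" where
  "qp_mon = (\<lambda>(i, s). weyl_q ^ s * weyl_p ^ i)"

lemma qp_mon_pair: "qp_mon (i, s) = weyl_q ^ s * weyl_p ^ i"
  by (simp add: qp_mon_def)

lemma qp_mon_origin: "qp_mon (0, 0) = 1"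
  by (simp add: qp_mon_pair)

lemma weyl_act_qp_mon: "weyl_act (qp_mon (i, s)) v = monom 1 s * (pderiv ^^ i) v"
  by (simp add: qp_mon_pair weyl_act_mult weyl_act_p_power weyl_act_q_power)

lemma higher_pderiv_monom_eq_0: "n < i \<Longrightarrow> (pderiv ^^ i) (monom c n) = 0"
proof (induction i arbitrary: c n)
  case (Suc i)
  then show ?case
    by (cases n) (simp_all add: funpow_Suc_right pderiv_monom monom_0 del: funpow.simps)
qed simp

lemma higher_pderiv_monom_self: "(pderiv ^^ n) (monom c n) = [:fact n * c:]"
proof (induction n arbitrary: c)
  case (Suc n)
  then show ?case
    by (simp add: funpow_Suc_right pderiv_monom algebra_simps del: funpow.simps)
qed (simp add: monom_0)

text \<open>
  Let \<open>i\<close> be the least power of \<open>p\<close> whose coefficients are not yet known to vanish. Applied to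
  \<open>x\<^sup>i\<close>, all terms with a higher power of \<open>p\<close> disappear, and \<open>q\<^sup>s p\<^sup>i\<close> gives \<open>i! x\<^sup>s\<close>, so the coefficients can
  be read off. Characteristic \<open>0\<close> enters through \<open>i! \<noteq> 0\<close>.
\<close>

lemma qp_mon_sum_eq_0:
  fixes c :: "nat \<times> nat \<Rightarrow> 'k::field_char_0"
  assumes "finite F" and zero: "(\<Sum>x\<in>F. c x *\<^sub>K qp_mon x) = 0"
  shows "(i, s) \<in> F \<Longrightarrow> c (i, s) = 0"
proof (induction i arbitrary: s rule: less_induct)
  case (less i)
  have act: "weyl_act (c (j, t) *\<^sub>K qp_mon (j, t)) (monom 1 i)
      = (if j = i then smult (c (j, t) * fact i) (monom 1 t) else 0)"
    if "(j, t) \<in> F" for j t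
  proof -
    consider "j < i" | "j = i" | "i < j" by linarith
    then show ?thesis
      using less.IH[of j t] that
      by cases
        (simp_all add: weyl_act_scale weyl_act_qp_mon higher_pderiv_monom_eq_0
          higher_pderiv_monom_self mult.commute)
  qed
  \<comment> \<open>Compare the coefficients of \<open>x\<^sup>s\<close>.\<close>
  have "0 = coeff (weyl_act (\<Sum>x\<in>F. c x *\<^sub>K qp_mon x) (monom 1 i)) s"
    by (simp add: zero)
  also have "\<dots> = (\<Sum>x\<in>F. coeff (weyl_act (c x *\<^sub>K qp_mon x) (monom 1 i)) s)"
    by (simp add: weyl_act_sum coeff_sum)
  also have "\<dots> = (\<Sum>x\<in>F. if x = (i, s) then c (i, s) * fact i else 0)"
  proof (rule sum.cong[OF refl])
    fix x assume "x \<in> F"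
    then show "coeff (weyl_act (c x *\<^sub>K qp_mon x) (monom 1 i)) s
        = (if x = (i, s) then c (i, s) * fact i else 0)"
      by (cases x) (simp add: act)
  qed
  also have "\<dots> = c (i, s) * fact i"
    using less.prems \<open>finite F\<close> by simp
  finally show ?case by simp
qed

lemma inj_qp_mon: "inj (qp_mon :: _ \<Rightarrow> 'k::field_char_0 weyl)"
proof (rule injI, rule ccontr)
  fix x y :: "nat \<times> nat"
  assume eq: "qp_mon x = (qp_mon y :: 'k weyl)" and "x \<noteq> y"
  let ?c = "\<lambda>u. if u = x then 1 else - 1 :: 'k"
  have "(\<Sum>u\<in>{x, y}. ?c u *\<^sub>K qp_mon u) = (0 :: 'k weyl)"
    using \<open>x \<noteq> y\<close> eq by simp
  then have "?c (fst x, snd x) = 0"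
    by (rule qp_mon_sum_eq_0[rotated]) simp_all
  then show False by simp
qed

lemma independent_qp_mon: "weyl.independent (range (qp_mon :: _ \<Rightarrow> 'k::field_char_0 weyl))"
  unfolding weyl.independent_explicit_finite_subsets
proof (intro allI impI ballI)
  fix S u and b :: "'k weyl"
  assume "S \<subseteq> range qp_mon" "finite S" "(\<Sum>v\<in>S. u v *\<^sub>K v) = 0" "b \<in> S"
  then obtain F where F: "finite F" "S = qp_mon ` F"
    by (metis finite_subset_image)
  have "(\<Sum>x\<in>F. u (qp_mon x) *\<^sub>K qp_mon x) = 0"
    using \<open>(\<Sum>v\<in>S. u v *\<^sub>K v) = 0\<close>
    by (simp add: F(2) sum.reindex[OF inj_on_subset[OF inj_qp_mon subset_UNIV]])
  then show "u b = 0"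
    using qp_mon_sum_eq_0[of F "\<lambda>x. u (qp_mon x)"] F \<open>b \<in> S\<close> by auto
qed

text \<open>
  A left ideal that contains \<open>1\<close> is everything, and to be a left ideal a subspace only has to absorb
  the two generators. This serves both to see that the ordered monomials span and to recognize
  a generating set.
\<close>

lemma subspace_closed_under_gens_eq_UNIV:
  fixes V :: "'k::field weyl set"
  assumes V: "weyl.subspace V" "1 \<in> V"
    and p: "\<And>a. a \<in> V \<Longrightarrow> weyl_p * a \<in> V" and q: "\<And>a. a \<in> V \<Longrightarrow> weyl_q * a \<in> V"
  shows "V = UNIV"
proof -
  have word: "abs_weyl (Poly_Mapping.single (Word l) 1) \<in> V" for l
  proof (induction l)
    case Nil
    then show ?case
      using V(2) by (simp add: one_weyl_def flip: zero_gen_word_def)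
  next
    case (Cons g l)
    have "Poly_Mapping.single (Word (g # l)) (1::'k)
        = free_gen g * Poly_Mapping.single (Word l) 1"
      by (simp add: free_gen_def mult_single plus_gen_word_def)
    then have "abs_weyl (Poly_Mapping.single (Word (g # l)) (1::'k))
        = abs_weyl (free_gen g) * abs_weyl (Poly_Mapping.single (Word l) 1)"
      by (simp add: times_weyl.abs_eq)
    with Cons show ?case
      by (cases g) (simp_all add: p q flip: weyl_p_def weyl_q_def)
  qed
  have "abs_weyl f \<in> V" for f
  proof (induction f rule: free_alg_induct)
    case zero
    then show ?case
      using weyl.subspace_0[OF V(1)] by (simp add: zero_weyl_def)
  next
    case (add f w c)
    have "Poly_Mapping.single w c = free_const c * Poly_Mapping.single (Word (letters w)) 1"
      by (simp add: free_const_def mult_single)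
    then have "abs_weyl (f + Poly_Mapping.single w c)
        = abs_weyl f + c *\<^sub>K abs_weyl (Poly_Mapping.single (Word (letters w)) 1)"
      by (simp add: plus_weyl.abs_eq weyl_scale.abs_eq)
    with add word[of "letters w"] show ?case
      using V(1) by (simp add: weyl.subspace_add weyl.subspace_scale del: gen_word.collapse)
  qed
  then show ?thesis
    by (metis (no_types, lifting) Quotient3_weyl Quotient3_def UNIV_eq_I)
qed

lemma weyl_p_q_power:
  "weyl_p * weyl_q ^ s = weyl_q ^ s * weyl_p + of_nat s *\<^sub>K weyl_q ^ (s - 1)"
proof (induction s)
  case (Suc s)
  have pq: "weyl_p * weyl_q = weyl_q * weyl_p + (1 :: 'a weyl)"
    using weyl_commutation by (simp add: algebra_simps)
  have "weyl_p * weyl_q ^ Suc s = weyl_q * (weyl_p * weyl_q ^ s) + (weyl_q ^ s :: 'a weyl)"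
    by (simp add: pq distrib_right flip: mult.assoc)
  also have "\<dots> = weyl_q ^ Suc s * weyl_p + of_nat s *\<^sub>K (weyl_q * weyl_q ^ (s - 1)) + weyl_q ^ s"
    by (simp add: Suc distrib_left weyl_scale_mult_right mult.assoc)
  also have "of_nat s *\<^sub>K (weyl_q * weyl_q ^ (s - 1)) = of_nat s *\<^sub>K (weyl_q ^ s :: 'a weyl)"
    by (cases s) simp_all
  finally show ?case
    by (simp add: weyl.scale_left_distrib algebra_simps)
qed simp

lemma weyl_p_mult_qp_mon:
  "weyl_p * qp_mon (i, s) = qp_mon (Suc i, s) + of_nat s *\<^sub>K qp_mon (i, s - 1)"
  by (simp add: qp_mon_pair weyl_p_q_power distrib_right weyl_scale_mult_left mult.assoc
      flip: mult.assoc[of weyl_p])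

lemma weyl_q_mult_qp_mon: "weyl_q * qp_mon (i, s) = qp_mon (i, Suc s)"
  by (simp add: qp_mon_pair mult.assoc)

lemma qp_mon_mult_weyl_p: "qp_mon (i, s) * weyl_p = qp_mon (Suc i, s)"
  by (simp add: qp_mon_pair mult.assoc power_commutes)

lemma span_qp_mon: "weyl.span (range qp_mon) = UNIV"
proof (rule subspace_closed_under_gens_eq_UNIV)
  let ?V = "weyl.span (range qp_mon) :: 'a weyl set"
  show "weyl.subspace ?V" by (rule weyl.subspace_span)
  show "1 \<in> ?V"
    by (metis qp_mon_origin rangeI weyl.span_base)
  have p: "weyl_p * qp_mon x \<in> ?V" for x
    by (cases x)
      (simp only: weyl_p_mult_qp_mon, intro weyl.span_add weyl.span_scale weyl.span_base rangeI)
  show "weyl_p * a \<in> ?V" if "a \<in> ?V" for a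
    using that
    by (induction rule: weyl.span_induct_alt)
      (auto simp: distrib_left weyl_scale_mult_right weyl.span_zero
        intro!: weyl.span_add weyl.span_scale p)
  have q: "weyl_q * qp_mon x \<in> ?V" for x
    by (cases x) (auto simp: weyl_q_mult_qp_mon intro!: weyl.span_base)
  show "weyl_q * a \<in> ?V" if "a \<in> ?V" for a
    using that
    by (induction rule: weyl.span_induct_alt)
      (auto simp: distrib_left weyl_scale_mult_right weyl.span_zero
        intro!: weyl.span_add weyl.span_scale q)
qed

definition qp_coeff :: "'k::field_char_0 weyl \<Rightarrow> nat \<times> nat \<Rightarrow> 'k" where
  "qp_coeff a x = weyl.representation (range qp_mon) a (qp_mon x)"

definition qp_supp :: "'k::field_char_0 weyl \<Rightarrow> (nat \<times> nat) set" where
  "qp_supp a = {x. qp_coeff a x \<noteq> 0}"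

lemma qp_coeff_add: "qp_coeff (a + b) x = qp_coeff a x + qp_coeff b x"
  and qp_coeff_diff: "qp_coeff (a - b) x = qp_coeff a x - qp_coeff b x"
  and qp_coeff_scale: "qp_coeff (c *\<^sub>K a) x = c * qp_coeff a x"
  by (simp_all add: qp_coeff_def weyl.representation_add weyl.representation_diff
      weyl.representation_scale independent_qp_mon span_qp_mon)

lemma qp_coeff_zero [simp]: "qp_coeff 0 x = 0"
  by (simp add: qp_coeff_def weyl.representation_zero)

lemma qp_coeff_sum: "qp_coeff (sum f A) x = (\<Sum>y\<in>A. qp_coeff (f y) x)"
  by (induction A rule: infinite_finite_induct) (simp_all add: qp_coeff_add)

lemma qp_coeff_qp_mon: "qp_coeff (qp_mon y) x = (if x = y then 1 else 0)"
  by (simp add: qp_coeff_def weyl.representation_basis independent_qp_mon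
      inj_eq[OF inj_qp_mon])

lemma qp_coeff_one: "qp_coeff 1 x = (if x = (0, 0) then 1 else 0)"
  by (simp add: qp_coeff_qp_mon flip: qp_mon_origin)

lemma finite_qp_supp: "finite (qp_supp a)"
proof -
  have "(qp_mon :: _ \<Rightarrow> 'a weyl) ` qp_supp a \<subseteq> {b. weyl.representation (range qp_mon) a b \<noteq> 0}"
    by (auto simp: qp_supp_def qp_coeff_def)
  then have "finite ((qp_mon :: _ \<Rightarrow> 'a weyl) ` qp_supp a)"
    by (rule finite_subset) (rule weyl.finite_representation)
  then show ?thesis
    by (rule finite_imageD) (rule inj_on_subset[OF inj_qp_mon subset_UNIV])
qed

lemma qp_expansion: "a = (\<Sum>x\<in>qp_supp a. qp_coeff a x *\<^sub>K qp_mon x)"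
proof -
  let ?r = "weyl.representation (range qp_mon) a"
  have "{b. ?r b \<noteq> 0} = qp_mon ` qp_supp a"
    using weyl.representation_ne_zero[of "range qp_mon" a]
    by (auto simp: qp_supp_def qp_coeff_def)
  then have "(\<Sum>b\<in>qp_mon ` qp_supp a. ?r b *\<^sub>K b) = a"
    using weyl.sum_nonzero_representation_eq[OF independent_qp_mon, of a]
    by (simp add: span_qp_mon)
  then show ?thesis
    by (simp add: qp_coeff_def sum.reindex[OF inj_on_subset[OF inj_qp_mon subset_UNIV]])
qed

lemma qp_supp_span_subset:
  assumes "a \<in> weyl.span (qp_mon ` A)"
  shows "qp_supp a \<subseteq> A"
  using assms
proof (induction rule: weyl.span_induct_alt)
  case base
  then show ?case by (simp add: qp_supp_def)
next
  case (step c b a)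
  then show ?case
    by (auto simp: qp_supp_def qp_coeff_add qp_coeff_scale qp_coeff_qp_mon split: if_splits)
qed

lemma subspace_qp_supp_subset: "weyl.subspace {a. qp_supp a \<subseteq> A}"
  by (rule weyl.subspaceI) (auto simp: qp_supp_def qp_coeff_add qp_coeff_scale subset_iff, force)

section \<open>Leading terms of products and commutators\<close>

text \<open>
  Moving \<open>p\<close> past \<open>q\<close> lowers both exponents by one, so all correction terms of a product lie
  on the diagonal below its leading exponent; \<open>k\<close> bounds the number of steps from below.
\<close>

definition diag_below :: "nat \<Rightarrow> nat \<times> nat \<Rightarrow> (nat \<times> nat) set" where
  "diag_below k x = {y. \<exists>m\<ge>k. fst y + m = fst x \<and> snd y + m = snd x}"

abbreviation diag_span :: "nat \<Rightarrow> nat \<times> nat \<Rightarrow> 'k::field weyl set" where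
  "diag_span k x \<equiv> weyl.span (qp_mon ` diag_below k x)"

lemma weyl_p_mult_diag_span:
  assumes "a \<in> diag_span k (i, s)"
  shows "weyl_p * a \<in> diag_span k (Suc i, s)"
  using assms
proof (induction rule: weyl.span_induct_alt)
  case (step c b a)
  then obtain i' s' m where b: "b = qp_mon (i', s')" "k \<le> m" "i' + m = i" "s' + m = s"
    by (auto simp: diag_below_def)
  have 1: "qp_mon (Suc i', s') \<in> diag_span k (Suc i, s)"
    using b by (intro weyl.span_base imageI) (auto simp: diag_below_def)
  have 2: "of_nat s' *\<^sub>K qp_mon (i', s' - 1) \<in> diag_span k (Suc i, s)"
  proof (cases s')
    case (Suc s'')
    then have "qp_mon (i', s' - 1) \<in> diag_span k (Suc i, s)"
      using b
      by (intro weyl.span_base imageI) (auto simp: diag_below_def intro!: exI[of _ "Suc m"])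
    then show ?thesis by (rule weyl.span_scale)
  qed (simp add: weyl.span_zero)
  show ?case
    by (simp only: b(1) distrib_left[of weyl_p] weyl_scale_mult_right weyl_p_mult_qp_mon)
      (rule weyl.span_add[OF weyl.span_scale[OF weyl.span_add[OF 1 2]] step.IH])
qed (simp add: weyl.span_zero)

lemma weyl_q_mult_diag_span:
  assumes "a \<in> diag_span k (i, s)"
  shows "weyl_q * a \<in> diag_span k (i, Suc s)"
  using assms
proof (induction rule: weyl.span_induct_alt)
  case (step c b a)
  then obtain i' s' m where b: "b = qp_mon (i', s')" "k \<le> m" "i' + m = i" "s' + m = s"
    by (auto simp: diag_below_def)
  then have "qp_mon (i', Suc s') \<in> diag_span k (i, Suc s)"
    by (intro weyl.span_base imageI) (auto simp: diag_below_def)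
  then show ?case
    using step b(1)
    by (auto simp: distrib_left weyl_scale_mult_right weyl_q_mult_qp_mon
        intro!: weyl.span_add weyl.span_scale)
qed (simp add: weyl.span_zero)

lemma diag_span_mult_weyl_p:
  assumes "a \<in> diag_span k (i, s)"
  shows "a * weyl_p \<in> diag_span k (Suc i, s)"
  using assms
proof (induction rule: weyl.span_induct_alt)
  case (step c b a)
  then obtain i' s' m where b: "b = qp_mon (i', s')" "k \<le> m" "i' + m = i" "s' + m = s"
    by (auto simp: diag_below_def)
  then have "qp_mon (Suc i', s') \<in> diag_span k (Suc i, s)"
    by (intro weyl.span_base imageI) (auto simp: diag_below_def)
  then show ?case
    using step b(1)
    by (auto simp: distrib_right weyl_scale_mult_left qp_mon_mult_weyl_p
        intro!: weyl.span_add weyl.span_scale)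
qed (simp add: weyl.span_zero)

lemma q_power_mult_diag_span_mult_p_power:
  assumes "a \<in> diag_span k (i, t)"
  shows "weyl_q ^ s * a * weyl_p ^ j \<in> diag_span k (i + j, s + t)"
proof -
  have "weyl_q ^ s * a \<in> diag_span k (i, s + t)"
    using assms by (induction s) (simp_all add: mult.assoc weyl_q_mult_diag_span)
  then show ?thesis
    by (induction j) (simp_all add: power_Suc2 diag_span_mult_weyl_p del: power_Suc flip: mult.assoc)
qed

text \<open>
  The expansion \<open>p\<^sup>i q\<^sup>t = q\<^sup>t p\<^sup>i + i t q\<^sup>t\<^sup>-\<^sup>1 p\<^sup>i\<^sup>-\<^sup>1 + \<dots>\<close> up to its second term; the second term is what
  survives in a commutator. Where the truncated exponents on the right would be wrong, the
  coefficient \<open>i t\<close> is zero.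
\<close>

lemma p_power_q_power:
  "weyl_p ^ i * weyl_q ^ t - (qp_mon (i, t) + of_nat (i * t) *\<^sub>K qp_mon (i - 1, t - 1))
    \<in> diag_span 2 (i, t)"
proof (induction i)
  case 0
  then show ?case by (simp add: qp_mon_pair weyl.span_zero)
next
  case (Suc i)
  define R :: "'a weyl" where
    "R = weyl_p ^ i * weyl_q ^ t - (qp_mon (i, t) + of_nat (i * t) *\<^sub>K qp_mon (i - 1, t - 1))"
  have "weyl_p ^ i * weyl_q ^ t = R + qp_mon (i, t) + of_nat (i * t) *\<^sub>K qp_mon (i - 1, t - 1)"
    by (simp add: R_def)
  then have "weyl_p ^ Suc i * weyl_q ^ t
      = weyl_p * R + weyl_p * qp_mon (i, t) + of_nat (i * t) *\<^sub>K (weyl_p * qp_mon (i - 1, t - 1))"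
    by (simp add: distrib_left weyl_scale_mult_right mult.assoc)
  also have "of_nat (i * t) *\<^sub>K (weyl_p * qp_mon (i - 1, t - 1))
      = of_nat (i * t) *\<^sub>K qp_mon (i, t - 1)
        + of_nat (i * t * (t - 1)) *\<^sub>K (qp_mon (i - 1, t - 2) :: 'a weyl)"
    by (cases i) (simp_all add: weyl_p_mult_qp_mon weyl.scale_right_distrib numeral_2_eq_2)
  finally have eq: "weyl_p ^ Suc i * weyl_q ^ t
      - (qp_mon (Suc i, t) + of_nat (Suc i * t) *\<^sub>K qp_mon (Suc i - 1, t - 1))
      = weyl_p * R + of_nat (i * t * (t - 1)) *\<^sub>K qp_mon (i - 1, t - 2)"
    by (simp add: weyl_p_mult_qp_mon weyl.scale_left_distrib algebra_simps)
  have "of_nat (i * t * (t - 1)) *\<^sub>K qp_mon (i - 1, t - 2)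
      \<in> (diag_span 2 (Suc i, t) :: 'a weyl set)"
  proof (cases "i * t * (t - 1) = 0")
    case True
    then have "of_nat (i * t * (t - 1)) = (0 :: 'a)"
      by (metis of_nat_0)
    then show ?thesis
      by (simp only: weyl.scale_zero_left weyl.span_zero)
  next
    case False
    then have "(i - 1, t - 2) \<in> diag_below 2 (Suc i, t)"
      by (auto simp: diag_below_def intro!: exI[of _ 2])
    then show ?thesis
      by (intro weyl.span_scale weyl.span_base imageI)
  qed
  with Suc show ?case
    unfolding eq by (simp add: R_def weyl.span_add weyl_p_mult_diag_span)
qed

lemma qp_mon_mult:
  "qp_mon (i, s) * qp_mon (j, t)
    - (qp_mon (i + j, s + t) + of_nat (i * t) *\<^sub>K qp_mon (i + j - 1, s + t - 1))
    \<in> diag_span 2 (i + j, s + t)"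
proof -
  let ?L = "weyl_q ^ s * (weyl_p ^ i * weyl_q ^ t
        - (qp_mon (i, t) + of_nat (i * t) *\<^sub>K qp_mon (i - 1, t - 1))) * weyl_p ^ j :: 'a weyl"
  have "?L = qp_mon (i, s) * qp_mon (j, t) - (qp_mon (i + j, s + t)
          + of_nat (i * t) *\<^sub>K qp_mon (i - 1 + j, s + (t - 1)))"
    by (simp add: qp_mon_pair right_diff_distrib left_diff_distrib distrib_left distrib_right
        weyl_scale_mult_left weyl_scale_mult_right power_add mult.assoc)
  also have "of_nat (i * t) *\<^sub>K (qp_mon (i - 1 + j, s + (t - 1)) :: 'a weyl)
      = of_nat (i * t) *\<^sub>K qp_mon (i + j - 1, s + t - 1)"
    by (cases i; cases t) simp_all
  finally have eq: "?L = qp_mon (i, s) * qp_mon (j, t)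
    - (qp_mon (i + j, s + t) + of_nat (i * t) *\<^sub>K qp_mon (i + j - 1, s + t - 1))" .
  have "?L \<in> diag_span 2 (i + j, s + t)"
    by (rule q_power_mult_diag_span_mult_p_power[OF p_power_q_power])
  then show ?thesis
    unfolding eq .
qed

text \<open>
  The leading terms of the two products cancel and the second terms leave the determinant of
  the two exponents: to this order the commutator is the Poisson bracket.
\<close>

lemma commutator_qp_mon:
  "commutator (qp_mon (i, s)) (qp_mon (j, t))
    - (of_nat (i * t) - of_nat (s * j)) *\<^sub>K qp_mon (i + j - 1, s + t - 1)
    \<in> diag_span 2 (i + j, s + t)"
  using weyl.span_diff[OF qp_mon_mult[of i s j t] qp_mon_mult[of j t i s, unfolded add.commute[of j i] add.commute[of t s]]]
  by (simp add: commutator_def weyl.scale_left_diff_distrib algebra_simps)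

lemma diag_below_antimono: "k \<le> l \<Longrightarrow> diag_below l x \<subseteq> diag_below k x"
  unfolding diag_below_def using order_trans by blast

lemma qp_supp_commutator_qp_mon:
  "qp_supp (commutator (qp_mon (i, s)) (qp_mon (j, t) :: 'k::field_char_0 weyl))
    \<subseteq> diag_below 1 (i + j, s + t)"
proof -
  let ?C = "commutator (qp_mon (i, s)) (qp_mon (j, t) :: 'k weyl)"
  let ?c = "of_nat (i * t) - of_nat (s * j) :: 'k"
  let ?m = "qp_mon (i + j - 1, s + t - 1) :: 'k weyl"
  have "diag_below 2 (i + j, s + t) \<subseteq> diag_below 1 (i + j, s + t)"
    by (rule diag_below_antimono) simp
  then have "?C - ?c *\<^sub>K ?m \<in> diag_span 1 (i + j, s + t)"
    using commutator_qp_mon[of i s j t] weyl.span_mono[OF image_mono] by blast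
  moreover have "?c *\<^sub>K ?m \<in> diag_span 1 (i + j, s + t)"
  proof (cases "i * t = s * j")
    case False
    then have "(i + j - 1, s + t - 1) \<in> diag_below 1 (i + j, s + t)"
      by (cases i; cases j; cases s; cases t) (auto simp: diag_below_def)
    then show ?thesis by (intro weyl.span_scale weyl.span_base imageI)
  qed (simp add: weyl.span_zero)
  ultimately have "(?C - ?c *\<^sub>K ?m) + ?c *\<^sub>K ?m \<in> diag_span 1 (i + j, s + t)"
    by (rule weyl.span_add)
  then show ?thesis
    using qp_supp_span_subset[of ?C] by simp
qed

lemma qp_coeff_commutator_qp_mon:
  assumes "i * t \<noteq> s * j"
  shows "qp_coeff (commutator (qp_mon (i, s)) (qp_mon (j, t))) (i + j - 1, s + t - 1)
    = (of_nat (i * t) - of_nat (s * j) :: 'k::field_char_0)"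
proof -
  let ?C = "commutator (qp_mon (i, s)) (qp_mon (j, t) :: 'k weyl)"
  let ?c = "of_nat (i * t) - of_nat (s * j) :: 'k"
  let ?x = "(i + j - 1, s + t - 1)"
  have "?x \<notin> diag_below 2 (i + j, s + t)"
    using assms by (cases i; cases j; cases s; cases t) (auto simp: diag_below_def)
  then have "qp_coeff (?C - ?c *\<^sub>K qp_mon ?x) ?x = 0"
    using qp_supp_span_subset[OF commutator_qp_mon[of i s j t]] by (auto simp: qp_supp_def)
  then show ?thesis
    by (simp add: qp_coeff_diff qp_coeff_scale qp_coeff_qp_mon del: of_nat_mult)
qed

lemma commutator_expansion:
  "commutator z w
    = (\<Sum>(x, y)\<in>qp_supp z \<times> qp_supp w.
        (qp_coeff z x * qp_coeff w y) *\<^sub>K commutator (qp_mon x) (qp_mon y))"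
proof -
  have prod: "a * b = (\<Sum>x\<in>qp_supp a. \<Sum>y\<in>qp_supp b.
      (qp_coeff a x * qp_coeff b y) *\<^sub>K (qp_mon x * qp_mon y))" for a b :: "'a weyl"
    by (subst qp_expansion[of a], subst qp_expansion[of b])
      (simp add: sum_product weyl_scale_mult_left weyl_scale_mult_right mult.commute)
  have "w * z = (\<Sum>x\<in>qp_supp z. \<Sum>y\<in>qp_supp w.
      (qp_coeff z x * qp_coeff w y) *\<^sub>K (qp_mon y * qp_mon x))"
    by (subst prod, subst sum.swap) (simp add: mult.commute)
  then show ?thesis
    by (simp add: commutator_def prod[of z w] sum.cartesian_product weyl.scale_right_diff_distrib
        case_prod_unfold sum_subtractf)
qed

section \<open>Leading exponents\<close>

definition weight :: "real \<Rightarrow> real \<Rightarrow> nat \<times> nat \<Rightarrow> real" where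
  "weight \<sigma> \<rho> x = \<sigma> * real (fst x) + \<rho> * real (snd x)"

text \<open>
  The tie-break by \<open>i + s\<close> makes it possible to use \<open>\<sigma> + \<rho> = 0\<close>, where the correction terms of a
  product have the same weight as its leading term, and it is invariant under exchanging
  the coordinates.
\<close>

definition precedes :: "real \<Rightarrow> real \<Rightarrow> nat \<times> nat \<Rightarrow> nat \<times> nat \<Rightarrow> bool" where
  "precedes \<sigma> \<rho> x y \<longleftrightarrow> weight \<sigma> \<rho> x < weight \<sigma> \<rho> y \<or>
     weight \<sigma> \<rho> x = weight \<sigma> \<rho> y \<and> fst x + snd x < fst y + snd y"

definition leading :: "real \<Rightarrow> real \<Rightarrow> (nat \<times> nat) set \<Rightarrow> nat \<times> nat \<Rightarrow> bool" where
  "leading \<sigma> \<rho> S x \<longleftrightarrow> x \<in> S \<and> (\<forall>y\<in>S. y = x \<or> precedes \<sigma> \<rho> y x)"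

lemma leading_in: "leading \<sigma> \<rho> S x \<Longrightarrow> x \<in> S"
  by (simp add: leading_def)

lemma leading_weight_le: "leading \<sigma> \<rho> S x \<Longrightarrow> y \<in> S \<Longrightarrow> weight \<sigma> \<rho> y \<le> weight \<sigma> \<rho> x"
  unfolding leading_def precedes_def by fastforce

lemma leading_tie:
  "leading \<sigma> \<rho> S x \<Longrightarrow> y \<in> S \<Longrightarrow> weight \<sigma> \<rho> y = weight \<sigma> \<rho> x \<Longrightarrow>
    fst y + snd y \<le> fst x + snd x"
  unfolding leading_def precedes_def by fastforce

lemma finite_ex_maximizer:
  fixes f :: "'a \<Rightarrow> 'b::linorder"
  assumes "finite S" "S \<noteq> {}"
  obtains x where "x \<in> S" "\<And>y. y \<in> S \<Longrightarrow> f y \<le> f x"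
proof -
  have "Max (f ` S) \<in> f ` S"
    using assms by simp
  then obtain x where "x \<in> S" "f x = Max (f ` S)" by (metis imageE)
  with assms(1) show thesis
    by (intro that) auto
qed

text \<open>
  Weight and tie-break together determine the exponent because the linear forms \<open>\<sigma> i + \<rho> s\<close> and
  \<open>i + s\<close> are linearly independent when \<open>\<sigma> \<noteq> \<rho>\<close>.
\<close>

lemma ex_leading:
  assumes "finite S" "S \<noteq> {}" and "\<sigma> \<noteq> \<rho>"
  obtains x where "leading \<sigma> \<rho> S x"
proof -
  obtain u where u: "u \<in> S" "\<And>y. y \<in> S \<Longrightarrow> weight \<sigma> \<rho> y \<le> weight \<sigma> \<rho> u"
    using finite_ex_maximizer[OF assms(1,2)] by blast
  let ?M = "{y \<in> S. weight \<sigma> \<rho> y = weight \<sigma> \<rho> u}"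
  have "finite ?M" "?M \<noteq> {}"
    using assms(1) u(1) by (simp, blast)
  then obtain x where x: "x \<in> ?M" "\<And>y. y \<in> ?M \<Longrightarrow> fst y + snd y \<le> fst x + snd x"
    using finite_ex_maximizer[of ?M "\<lambda>y. fst y + snd y"] by blast
  have "y = x \<or> precedes \<sigma> \<rho> y x" if "y \<in> S" for y
  proof (cases "weight \<sigma> \<rho> y = weight \<sigma> \<rho> x \<and> fst y + snd y = fst x + snd x")
    case True
    then have "real (snd y) = real (fst x) + real (snd x) - real (fst y)"
      by linarith
    with True have "(\<sigma> - \<rho>) * (real (fst y) - real (fst x)) = 0"
      by (simp add: weight_def algebra_simps)
    with \<open>\<sigma> \<noteq> \<rho>\<close> True show ?thesis
      by (auto simp: prod_eq_iff)
  next
    case False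
    then show ?thesis
      using x u(2)[OF that] that by (fastforce simp: precedes_def)
  qed
  with x(1) show thesis
    by (intro that) (auto simp: leading_def)
qed

text \<open>
  A pair of monomials other than the leading pair cannot contribute at this exponent: its
  product would have to lie on or above the product of the leading pair along the diagonal,
  hence be at least as large, whereas the order is additive and one factor is strictly
  smaller.
\<close>

lemma qp_coeff_commutator_leading:
  fixes z w :: "'k::field_char_0 weyl"
  assumes "0 \<le> \<sigma> + \<rho>"
    and z: "leading \<sigma> \<rho> (qp_supp z) (i, s)" and w: "leading \<sigma> \<rho> (qp_supp w) (j, t)"
    and "i * t \<noteq> s * j"
  shows "qp_coeff (commutator z w) (i + j - 1, s + t - 1)
    = qp_coeff z (i, s) * qp_coeff w (j, t) * (of_nat (i * t) - of_nat (s * j))"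
proof -
  let ?\<tau> = "(i + j - 1, s + t - 1)"
  let ?g = "\<lambda>x y. qp_coeff z x * qp_coeff w y
    * qp_coeff (commutator (qp_mon x) (qp_mon y)) ?\<tau>"
  have pos: "0 < i + j" "0 < s + t"
    using assms(4) by (auto intro: ccontr)
  have other: "qp_coeff (commutator (qp_mon x) (qp_mon y)) ?\<tau> = (0 :: 'k)"
    if xy: "x \<in> qp_supp z" "y \<in> qp_supp w" "(x, y) \<noteq> ((i, s), (j, t))" for x y
  proof (rule ccontr)
    assume ne: "\<not> ?thesis"
    obtain a b c d where x: "x = (a, b)" and y: "y = (c, d)"
      by (metis surj_pair)
    have "?\<tau> \<in> diag_below 1 (a + c, b + d)"
      using ne qp_supp_commutator_qp_mon[where 'k = 'k, of a b c d] by (auto simp: x y qp_supp_def)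
    then obtain m where "1 \<le> m" "i + j - 1 + m = a + c" "s + t - 1 + m = b + d"
      by (auto simp: diag_below_def)
    then obtain n where n: "a + c = i + j + n" "b + d = s + t + n"
      using pos by (intro that[of "m - 1"]) auto
    have "weight \<sigma> \<rho> x + weight \<sigma> \<rho> y
        = \<sigma> * real (a + c) + \<rho> * real (b + d)"
      by (simp add: weight_def x y algebra_simps)
    also have "\<dots> = weight \<sigma> \<rho> (i, s) + weight \<sigma> \<rho> (j, t) + (\<sigma> + \<rho>) * real n"
      unfolding n by (simp add: weight_def algebra_simps)
    finally have "weight \<sigma> \<rho> (i, s) + weight \<sigma> \<rho> (j, t) \<le> weight \<sigma> \<rho> x + weight \<sigma> \<rho> y"
      using assms(1) by simp
    moreover have "x = (i, s) \<or> precedes \<sigma> \<rho> x (i, s)" "y = (j, t) \<or> precedes \<sigma> \<rho> y (j, t)"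
      using z w xy by (auto simp: leading_def)
    moreover have "i + j + (s + t) \<le> fst x + snd x + (fst y + snd y)"
      using n by (simp add: x y)
    ultimately show False
      using xy(3) by (auto simp: precedes_def)
  qed
  have "qp_coeff (commutator z w) ?\<tau> = (\<Sum>(x, y)\<in>qp_supp z \<times> qp_supp w. ?g x y)"
    by (subst commutator_expansion) (simp add: qp_coeff_sum qp_coeff_scale case_prod_unfold)
  also have "\<dots> = (\<Sum>u\<in>qp_supp z \<times> qp_supp w.
      if u = ((i, s), (j, t)) then ?g (i, s) (j, t) else 0)"
  proof (rule sum.cong[OF refl])
    fix u assume "u \<in> qp_supp z \<times> qp_supp w"
    then show "(case u of (x, y) \<Rightarrow> ?g x y)
        = (if u = ((i, s), (j, t)) then ?g (i, s) (j, t) else 0)"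
      using other[of "fst u" "snd u"]
      by (cases "u = ((i, s), (j, t))") (simp_all add: case_prod_unfold mem_Times_iff)
  qed
  also have "\<dots> = ?g (i, s) (j, t)"
    using leading_in[OF z] leading_in[OF w] by (simp add: finite_qp_supp)
  finally show ?thesis
    by (simp only: qp_coeff_commutator_qp_mon[OF assms(4)])
qed

text \<open>
  All that the Newton polygons retain of the equation \<open>[z, w] = 1\<close>.
\<close>

definition unit_bracket :: "(nat \<times> nat) set \<Rightarrow> (nat \<times> nat) set \<Rightarrow> bool" where
  "unit_bracket S T \<longleftrightarrow> (\<forall>\<sigma> \<rho> i s j t.
     0 \<le> \<sigma> + \<rho> \<longrightarrow> leading \<sigma> \<rho> S (i, s) \<longrightarrow> leading \<sigma> \<rho> T (j, t) \<longrightarrow>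
     i * t = s * j \<or> i + j = 1 \<and> s + t = 1)"

lemma unit_bracketD:
  assumes "unit_bracket S T" "0 \<le> \<sigma> + \<rho>" "leading \<sigma> \<rho> S (i, s)" "leading \<sigma> \<rho> T (j, t)"
    and "i * t \<noteq> s * j"
  shows "i + j = 1" "s + t = 1"
  using assms unfolding unit_bracket_def by blast+

lemma unit_bracket_qp_supp:
  fixes z w :: "'k::field_char_0 weyl"
  assumes "commutator z w = 1"
  shows "unit_bracket (qp_supp z) (qp_supp w)"
  unfolding unit_bracket_def
proof (intro allI impI)
  fix \<sigma> \<rho> :: real and i s j t :: nat
  assume "0 \<le> \<sigma> + \<rho>" and z: "leading \<sigma> \<rho> (qp_supp z) (i, s)"
    and w: "leading \<sigma> \<rho> (qp_supp w) (j, t)"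
  show "i * t = s * j \<or> i + j = 1 \<and> s + t = 1"
  proof (cases "i * t = s * j")
    case ne: False
    then have "(of_nat (i * t) - of_nat (s * j) :: 'k) \<noteq> 0"
      by (simp del: of_nat_mult)
    then have "qp_coeff (commutator z w) (i + j - 1, s + t - 1) \<noteq> 0"
      using qp_coeff_commutator_leading[OF \<open>0 \<le> \<sigma> + \<rho>\<close> z w ne] leading_in[OF z] leading_in[OF w]
      by (simp add: qp_supp_def del: of_nat_mult)
    then have "i + j - 1 = 0" "s + t - 1 = 0"
      using assms by (auto simp: qp_coeff_one split: if_splits)
    moreover have "i + j \<noteq> 0" "s + t \<noteq> 0"
      using ne by auto
    ultimately have "i + j = 1 \<and> s + t = 1" by linarith
    then show ?thesis by simp
  qed simp
qed

lemma leading_swap: "leading \<sigma> \<rho> (prod.swap ` S) x \<longleftrightarrow> leading \<rho> \<sigma> S (prod.swap x)"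
proof -
  have precedes: "precedes \<sigma> \<rho> (prod.swap y) x \<longleftrightarrow> precedes \<rho> \<sigma> y (prod.swap x)" for y
    by (simp add: precedes_def weight_def add.commute)
  have eq: "prod.swap y = x \<longleftrightarrow> y = prod.swap x" for y
    by auto
  then have "x \<in> prod.swap ` S \<longleftrightarrow> prod.swap x \<in> S"
    by force
  then show ?thesis
    by (simp add: leading_def precedes eq)
qed

lemma unit_bracket_swap:
  assumes "unit_bracket S T"
  shows "unit_bracket (prod.swap ` S) (prod.swap ` T)"
  unfolding unit_bracket_def leading_swap
proof (intro allI impI)
  fix \<sigma> \<rho> :: real and i s j t :: nat
  assume "0 \<le> \<sigma> + \<rho>" and x: "leading \<rho> \<sigma> S (prod.swap (i, s))"
    and y: "leading \<rho> \<sigma> T (prod.swap (j, t))"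
  then show "i * t = s * j \<or> i + j = 1 \<and> s + t = 1"
    using unit_bracketD[OF assms, of \<rho> \<sigma> s i t j] by (cases "s * j = i * t") auto
qed

section \<open>Newton polygons of pairs with bracket one\<close>

text \<open>
  The leading exponent of \<open>T\<close> lies strictly on the side \<open>t < j\<close> of the diagonal and that of \<open>S\<close> weakly on
  the other, so they are not parallel. Their sum is then \<open>(1, 1)\<close>, which leaves \<open>(0, 1)\<close> and \<open>(1, 0)\<close>;
  all other exponents are smaller than these in the order.
\<close>

lemma unit_bracket_first_edge:
  assumes fin: "finite S" "finite T" and ub: "unit_bracket S T"
    and S: "S \<noteq> {}" "(0, 0) \<notin> S" "\<And>i s. (i, s) \<in> S \<Longrightarrow> i \<le> s"
    and T: "\<exists>(j, t)\<in>T. t < j"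
  shows "(0, 1) \<in> S" "(1, 0) \<in> T"
    and "\<And>i s. (i, s) \<in> S \<Longrightarrow> (i, s) = (0, 1) \<or> i + 2 \<le> s"
    and "\<And>j t. (j, t) \<in> T \<Longrightarrow> (j, t) = (1, 0) \<or> j \<le> t"
proof -
  obtain i s where x: "leading 1 (- 1) S (i, s)"
    using ex_leading[of S 1 "- 1"] fin S(1) by auto
  obtain j t where y: "leading 1 (- 1) T (j, t)"
    using ex_leading[of T 1 "- 1"] fin T by auto
  have "t < j"
  proof -
    obtain j' t' where "(j', t') \<in> T" "t' < j'" using T by auto
    then show ?thesis using leading_weight_le[OF y] by (fastforce simp: weight_def)
  qed
  have "i \<le> s" "0 < s"
    using leading_in[OF x] S(2,3) by (auto intro: ccontr)
  have "i * t < s * j"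
  proof -
    have "i * t \<le> s * t" using \<open>i \<le> s\<close> by simp
    also have "\<dots> < s * j" using \<open>t < j\<close> \<open>0 < s\<close> by simp
    finally show ?thesis .
  qed
  then have "i + j = 1" "s + t = 1"
    using unit_bracketD[OF ub _ x y] by auto
  then have eqs: "i = 0" "s = 1" "j = 1" "t = 0"
    using \<open>t < j\<close> \<open>0 < s\<close> by auto
  show "(0, 1) \<in> S" "(1, 0) \<in> T"
    using leading_in[OF x] leading_in[OF y] eqs by auto
  show "(i', s') = (0, 1) \<or> i' + 2 \<le> s'" if "(i', s') \<in> S" for i' s'
  proof -
    have "(i', s') = (0, 1) \<or> precedes 1 (- 1) (i', s') (0, 1)"
      using x that by (auto simp: leading_def eqs)
    then show ?thesis
      by (auto simp: precedes_def weight_def)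
  qed
  show "(j', t') = (1, 0) \<or> j' \<le> t'" if "(j', t') \<in> T" for j' t'
  proof -
    have "(j', t') = (1, 0) \<or> precedes 1 (- 1) (j', t') (1, 0)"
      using y that by (auto simp: leading_def eqs)
    then show ?thesis
      by (auto simp: precedes_def weight_def)
  qed
qed

text \<open>
  Seen from \<open>(0, 1)\<close>, an exponent \<open>(i, s)\<close> of \<open>S\<close> has slope \<open>i / (s - 1)\<close>; seen from \<open>(1, 0)\<close>, an exponent
  \<open>(j, t)\<close> of \<open>T\<close> has slope \<open>(j - 1) / t\<close>. If \<open>\<theta>\<close> is the largest positive slope, the weight \<open>i - \<theta> s\<close> is maximal on
  \<open>S\<close> exactly on the line of slope \<open>\<theta>\<close> through \<open>(0, 1)\<close>, and on \<open>T\<close> on the parallel line through \<open>(1, 0)\<close>. One of the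
  leading exponents on these lines is new, and \<open>\<theta> (i t - s j) = -(i + \<theta> j) < 0\<close> contradicts the
  hypothesis.
\<close>

lemma unit_bracket_no_second_edge:
  assumes fin: "finite S" "finite T" and ub: "unit_bracket S T"
    and in01: "(0, 1) \<in> S" "(1, 0) \<in> T"
    and S: "\<And>i s. (i, s) \<in> S \<Longrightarrow> (i, s) = (0, 1) \<or> i + 2 \<le> s"
    and T: "\<And>j t. (j, t) \<in> T \<Longrightarrow> (j, t) = (1, 0) \<or> j \<le> t"
  shows "(\<forall>(i, s)\<in>S. i = 0) \<and> (\<forall>(j, t)\<in>T. j \<le> 1)"
proof (rule ccontr)
  assume contra: "\<not> ?thesis"
  define slopes where "slopes = (\<lambda>(i, s). real i / (real s - 1)) ` {x \<in> S. 0 < fst x}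
    \<union> (\<lambda>(j, t). (real j - 1) / real t) ` {y \<in> T. 1 < fst y}"
  define \<theta> where "\<theta> = Max slopes"
  have "finite slopes" "slopes \<noteq> {}"
    using fin contra by (auto simp: slopes_def)
  then have "\<theta> \<in> slopes" and slope_le: "\<And>r. r \<in> slopes \<Longrightarrow> r \<le> \<theta>"
    by (auto simp: \<theta>_def)
  have slope_bounds: "0 < r \<and> r < 1" if "r \<in> slopes" for r
    using that S T by (force simp: slopes_def)
  have "0 < \<theta>" "\<theta> < 1"
    using slope_bounds[OF \<open>\<theta> \<in> slopes\<close>] by auto
  have wS: "weight 1 (- \<theta>) (i, s) \<le> - \<theta>" if "(i, s) \<in> S" for i s
  proof (cases "i = 0")
    case True
    then have "1 \<le> s" using S[OF that] by auto
    then show ?thesis using True \<open>0 < \<theta>\<close> by (simp add: weight_def)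
  next
    case False
    then have "real i / (real s - 1) \<le> \<theta>"
      using that by (intro slope_le) (force simp: slopes_def)
    moreover have "0 < real s - 1" using S[OF that] False by auto
    ultimately have "real i \<le> \<theta> * (real s - 1)" by (simp add: divide_le_eq)
    then show ?thesis by (simp add: weight_def algebra_simps)
  qed
  have wT: "weight 1 (- \<theta>) (j, t) \<le> 1" if "(j, t) \<in> T" for j t
  proof (cases "j \<le> 1")
    case True
    then have "real j \<le> 1" "0 \<le> \<theta> * real t" using \<open>0 < \<theta>\<close> by auto
    then show ?thesis by (simp add: weight_def)
  next
    case False
    then have "(real j - 1) / real t \<le> \<theta>"
      using that by (intro slope_le) (force simp: slopes_def)
    moreover have "0 < real t" using T[OF that] False by auto
    ultimately have "real j - 1 \<le> \<theta> * real t" by (simp add: divide_le_eq)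
    then show ?thesis by (simp add: weight_def)
  qed
  obtain i s where x: "leading 1 (- \<theta>) S (i, s)"
    using ex_leading[of S 1 "- \<theta>"] fin in01 \<open>0 < \<theta>\<close> by auto
  obtain j t where y: "leading 1 (- \<theta>) T (j, t)"
    using ex_leading[of T 1 "- \<theta>"] fin in01 \<open>0 < \<theta>\<close> by auto
  have wx: "weight 1 (- \<theta>) (i, s) = - \<theta>"
  proof (rule antisym)
    show "- \<theta> \<le> weight 1 (- \<theta>) (i, s)"
      using leading_weight_le[OF x in01(1)] by (simp add: weight_def)
  qed (rule wS[OF leading_in[OF x]])
  have wy: "weight 1 (- \<theta>) (j, t) = 1"
  proof (rule antisym)
    show "1 \<le> weight 1 (- \<theta>) (j, t)"
      using leading_weight_le[OF y in01(2)] by (simp add: weight_def)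
  qed (rule wT[OF leading_in[OF y]])
  have i: "real i = \<theta> * (real s - 1)" and j: "real j = 1 + \<theta> * real t"
    using wx wy unfolding weight_def right_diff_distrib by simp_all
  have "1 \<le> real j" using j \<open>0 < \<theta>\<close> by simp
  \<comment> \<open>The tie-break prefers the new exponent that attains \<open>\<theta>\<close> to the old one on the same line.\<close>
  have "i \<noteq> 0 \<or> 1 < j"
  proof -
    consider i' s' where "(i', s') \<in> S" "0 < i'" "\<theta> = real i' / (real s' - 1)"
      | j' t' where "(j', t') \<in> T" "1 < j'" "\<theta> = (real j' - 1) / real t'"
      using \<open>\<theta> \<in> slopes\<close> by (auto simp: slopes_def)
    then show ?thesis
    proof cases
      case 1
      have "1 < s'" using S[OF 1(1)] 1(2) by auto
      then have "weight 1 (- \<theta>) (i', s') = - \<theta>"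
        using 1(3) by (simp add: weight_def field_simps)
      then have "i' + s' \<le> i + s"
        using leading_tie[OF x 1(1)] wx by simp
      moreover have "s = 1" if "i = 0"
        using that i \<open>0 < \<theta>\<close> by auto
      ultimately show ?thesis using 1(2) \<open>1 < s'\<close> by auto
    next
      case 2
      have "0 < t'" using T[OF 2(1)] 2(2) by auto
      then have "weight 1 (- \<theta>) (j', t') = 1"
        using 2(3) by (simp add: weight_def field_simps)
      then have "j' + t' \<le> j + t"
        using leading_tie[OF y 2(1)] wy by simp
      moreover have "t = 0" if "j = 1"
        using that j \<open>0 < \<theta>\<close> by auto
      moreover have "1 \<le> j" using \<open>1 \<le> real j\<close> by simp
      ultimately show ?thesis using 2(2) by (cases "j = 1") auto
    qed
  qed
  have "i * t \<noteq> s * j"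
  proof
    assume "i * t = s * j"
    then have "real i * real t = real s * real j"
      by (metis of_nat_mult)
    then have "real i * (\<theta> * real t) = (\<theta> * real s) * real j"
      by (simp add: algebra_simps)
    moreover have "\<theta> * real t = real j - 1" "\<theta> * real s = real i + \<theta>"
      using i j by (simp_all add: algebra_simps)
    ultimately have "real i + \<theta> * real j = 0"
      by (simp add: algebra_simps)
    moreover have "0 < \<theta> * real j"
      using \<open>0 < \<theta>\<close> \<open>1 \<le> real j\<close> by simp
    ultimately show False
      using of_nat_0_le_iff[of i, where 'a = real] by linarith
  qed
  then have "i + j = 1"
    using unit_bracketD(1)[OF ub _ x y] \<open>\<theta> < 1\<close> by simp
  with \<open>i \<noteq> 0 \<or> 1 < j\<close> \<open>1 \<le> real j\<close> show False by auto
qed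

text \<open>
  A weight in which \<open>p\<close> outweighs every power of \<open>q\<close> in \<open>T\<close> makes the leading exponents \<open>(0, s)\<close> and
  \<open>(1, t)\<close>. They are not parallel as \<open>s > 0\<close>, so \<open>s + t = 1\<close>, that is \<open>s = 1\<close> and \<open>t = 0\<close>.
\<close>

lemma unit_bracket_last_edge:
  assumes fin: "finite S" "finite T" and ub: "unit_bracket S T"
    and in01: "(0, 1) \<in> S" "(1, 0) \<in> T" and "(0, 0) \<notin> S"
    and S: "\<And>i s. (i, s) \<in> S \<Longrightarrow> i = 0" and T: "\<And>j t. (j, t) \<in> T \<Longrightarrow> j \<le> 1"
  shows "S = {(0, 1)}" "T \<subseteq> insert (1, 0) (range (Pair 0))"
proof -
  define M where "M = real (Max (snd ` T)) + 2"
  have M: "real t + 2 \<le> M" if "(j, t) \<in> T" for j t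
  proof -
    have "t \<in> snd ` T" using that by (metis image_eqI snd_conv)
    then have "t \<le> Max (snd ` T)" using fin(2) by simp
    then show ?thesis by (simp add: M_def)
  qed
  have "M \<noteq> 1" "0 \<le> M + 1" by (simp_all add: M_def)
  obtain i s where x: "leading M 1 S (i, s)"
    using ex_leading[of S M 1] fin in01 \<open>M \<noteq> 1\<close> by auto
  obtain j t where y: "leading M 1 T (j, t)"
    using ex_leading[of T M 1] fin in01 \<open>M \<noteq> 1\<close> by auto
  have "i = 0" using S leading_in[OF x] by simp
  then have "0 < s" using leading_in[OF x] \<open>(0, 0) \<notin> S\<close> by (auto intro: ccontr)
  have "j = 1"
  proof (rule ccontr)
    assume "j \<noteq> 1"
    then have "j = 0" using T[OF leading_in[OF y]] by simp
    then show False
      using leading_weight_le[OF y in01(2)] M[OF leading_in[OF y]] by (simp add: weight_def)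
  qed
  have "s + t = 1"
    using unit_bracketD(2)[OF ub \<open>0 \<le> M + 1\<close> x y] \<open>i = 0\<close> \<open>j = 1\<close> \<open>0 < s\<close> by simp
  then have "s = 1" "t = 0" using \<open>0 < s\<close> by auto
  have "x' = (0, 1)" if "x' \<in> S" for x'
  proof (cases x')
    case (Pair i' s')
    with that have that: "(i', s') \<in> S" by simp
    have "s' \<noteq> 0" using S[OF that] that \<open>(0, 0) \<notin> S\<close> by (auto intro: ccontr)
    then show ?thesis
      using leading_weight_le[OF x that] S[OF that] \<open>i = 0\<close> \<open>s = 1\<close> by (simp add: weight_def Pair)
  qed
  with in01(1) show "S = {(0, 1)}" by blast
  have "(j', t') \<in> insert (1, 0) (range (Pair 0))" if "(j', t') \<in> T" for j' t'
  proof (cases "j' = 0")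
    case False
    then have "j' = 1" using T[OF that] by linarith
    then show ?thesis
      using leading_weight_le[OF y that] unfolding \<open>j' = 1\<close> \<open>j = 1\<close> \<open>t = 0\<close>
      by (simp add: weight_def)
  qed simp
  then show "T \<subseteq> insert (1, 0) (range (Pair 0))" by (intro subrelI)
qed

text \<open>
  In terms of elements: \<open>S\<close> is the support of a multiple of \<open>q\<close>, and \<open>T\<close> that of \<open>\<beta> p + h(q)\<close>.
\<close>

lemma unit_bracket_shape:
  assumes fin: "finite S" "finite T" and ub: "unit_bracket S T"
    and S: "S \<noteq> {}" "(0, 0) \<notin> S" "\<And>i s. (i, s) \<in> S \<Longrightarrow> i \<le> s"
    and T: "\<exists>(j, t)\<in>T. t < j"
  shows "S = {(0, 1)}" "(1, 0) \<in> T" "T \<subseteq> insert (1, 0) (range (Pair 0))"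
proof -
  note first = unit_bracket_first_edge[OF assms]
  have second: "(\<forall>(i, s)\<in>S. i = 0) \<and> (\<forall>(j, t)\<in>T. j \<le> 1)"
    by (rule unit_bracket_no_second_edge[OF fin ub first])
  show "(1, 0) \<in> T" by (rule first)
  show "S = {(0, 1)}" "T \<subseteq> insert (1, 0) (range (Pair 0))"
    using second unit_bracket_last_edge[OF fin ub first(1,2) S(2)] by blast+
qed

section \<open>The graded parts\<close>

lemma p_power_q_power_in_diag_span: "weyl_p ^ i * weyl_q ^ s \<in> diag_span 0 (i, s)"
proof -
  have "weyl_p ^ i * weyl_q ^ s \<in> diag_span 0 (i, 0 + s)"
  proof (induction i)
    case 0
    have "(0, s) \<in> diag_below 0 (0, s)" by (simp add: diag_below_def)
    then show ?case by (metis weyl.span_base imageI qp_mon_pair power_0 mult_1 mult_1_right add_0)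
  qed (simp add: mult.assoc weyl_p_mult_diag_span)
  then show ?thesis by simp
qed

lemma qp_supp_p_power_q_power: "qp_supp (weyl_p ^ i * weyl_q ^ s) \<subseteq> diag_below 0 (i, s)"
  by (rule qp_supp_span_subset[OF p_power_q_power_in_diag_span])

text \<open>
  The \<open>D\<^sub>t\<close> are spanned by monomials with \<open>p\<close> on the left. Reordering moves exponents along diagonals only,
  so conditions that depend on \<open>s - i\<close> alone can be tested on the supports.
\<close>

lemma span_weyl_D_qp_supp:
  assumes "\<And>i s. int s - int i \<in> I \<Longrightarrow> diag_below 0 (i, s) \<subseteq> A"
  shows "weyl.span (\<Union>t\<in>I. weyl_D t) \<subseteq> {a :: 'k::field_char_0 weyl. qp_supp a \<subseteq> A}"
proof (rule weyl.span_minimal[OF _ subspace_qp_supp_subset])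
  have "weyl_D t \<subseteq> {a :: 'k weyl. qp_supp a \<subseteq> A}" if "t \<in> I" for t
    unfolding weyl_D_def
  proof (rule weyl.span_minimal[OF _ subspace_qp_supp_subset], clarify)
    fix i s and x
    assume "t = int s - int i" and "x \<in> qp_supp (weyl_p ^ i * weyl_q ^ s :: 'k weyl)"
    with that assms[of s i] qp_supp_p_power_q_power[of i s] show "x \<in> A" by blast
  qed
  then show "(\<Union>t\<in>I. weyl_D t) \<subseteq> {a :: 'k weyl. qp_supp a \<subseteq> A}" by blast
qed

lemma qp_supp_D_nonneg:
  assumes "a \<in> weyl_D_nonneg" "(i, s) \<in> qp_supp a"
  shows "i \<le> s"
proof -
  have "weyl_D_nonneg \<subseteq> {a :: 'a weyl. qp_supp a \<subseteq> {x. fst x \<le> snd x}}"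
    unfolding weyl_D_nonneg_def by (rule span_weyl_D_qp_supp) (auto simp: diag_below_def)
  with assms show ?thesis by force
qed

lemma qp_supp_D_nonpos:
  assumes "a \<in> weyl_D_nonpos" "(i, s) \<in> qp_supp a"
  shows "s \<le> i"
proof -
  have "weyl_D_nonpos \<subseteq> {a :: 'a weyl. qp_supp a \<subseteq> {x. snd x \<le> fst x}}"
    unfolding weyl_D_nonpos_def by (rule span_weyl_D_qp_supp) (auto simp: diag_below_def)
  with assms show ?thesis by force
qed

text \<open>
  The action on \<open>K[x]/(x)\<close>: operators that do not lower degrees preserve the ideal \<open>(x)\<close> and
  act on the quotient by a scalar.
\<close>

lemma coeff_0_weyl_act_nonneg:
  assumes "\<And>i s. (i, s) \<in> qp_supp a \<Longrightarrow> i \<le> s"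
  shows "coeff (weyl_act a v) 0 = qp_coeff a (0, 0) * coeff v 0"
proof -
  have "coeff (weyl_act a v) 0
      = (\<Sum>x\<in>qp_supp a. qp_coeff a x * coeff (weyl_act (qp_mon x) v) 0)"
    by (subst qp_expansion[of a]) (simp add: weyl_act_sum weyl_act_scale coeff_sum)
  also have "\<dots> = (\<Sum>x\<in>qp_supp a. if x = (0, 0) then qp_coeff a (0, 0) * coeff v 0 else 0)"
  proof (rule sum.cong[OF refl])
    fix x assume "x \<in> qp_supp a"
    then show "qp_coeff a x * coeff (weyl_act (qp_mon x) v) 0
        = (if x = (0, 0) then qp_coeff a (0, 0) * coeff v 0 else 0)"
      using assms by (cases x) (auto simp: weyl_act_qp_mon coeff_mult_0 monom_0)
  qed
  also have "\<dots> = qp_coeff a (0, 0) * coeff v 0"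
    by (simp add: sum.delta[OF finite_qp_supp]) (simp add: qp_supp_def)
  finally show ?thesis .
qed

text \<open>
  The mirror image: operators that do not raise degrees preserve the line of constants.
\<close>

lemma weyl_act_one_nonpos:
  assumes "\<And>i s. (i, s) \<in> qp_supp a \<Longrightarrow> s \<le> i"
  shows "weyl_act a 1 = [:qp_coeff a (0, 0):]"
proof -
  have "weyl_act a 1 = (\<Sum>x\<in>qp_supp a. smult (qp_coeff a x) (weyl_act (qp_mon x) 1))"
    by (subst qp_expansion[of a]) (simp add: weyl_act_sum weyl_act_scale)
  also have "\<dots> = (\<Sum>x\<in>qp_supp a. if x = (0, 0) then [:qp_coeff a (0, 0):] else 0)"
  proof (rule sum.cong[OF refl])
    fix x assume "x \<in> qp_supp a"
    then show "smult (qp_coeff a x) (weyl_act (qp_mon x) 1)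
        = (if x = (0, 0) then [:qp_coeff a (0, 0):] else 0)"
      using assms higher_pderiv_monom_eq_0[of 0 "fst x" "1 :: 'a"]
      by (cases x) (auto simp: weyl_act_qp_mon monom_0 simp flip: one_pCons)
  qed
  also have "\<dots> = [:qp_coeff a (0, 0):]"
    by (simp add: sum.delta[OF finite_qp_supp]) (simp add: qp_supp_def)
  finally show ?thesis .
qed

lemma commutator_neq_1_nonneg:
  assumes "\<And>i s. (i, s) \<in> qp_supp z \<Longrightarrow> i \<le> s" "\<And>i s. (i, s) \<in> qp_supp w \<Longrightarrow> i \<le> s"
  shows "commutator z w \<noteq> 1"
proof
  assume "commutator z w = 1"
  then have "coeff (weyl_act (commutator z w) 1) 0 = 1" by simp
  then show False
    using assms
    by (simp add: commutator_def weyl_act_diff weyl_act_mult coeff_0_weyl_act_nonneg)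
qed

lemma commutator_neq_1_nonpos:
  assumes "\<And>i s. (i, s) \<in> qp_supp z \<Longrightarrow> s \<le> i" "\<And>i s. (i, s) \<in> qp_supp w \<Longrightarrow> s \<le> i"
  shows "commutator z w \<noteq> 1"
proof
  assume "commutator z w = 1"
  then have "weyl_act (commutator z w) 1 = 1" by simp
  moreover have "weyl_act b (weyl_act a 1) = [:qp_coeff b (0, 0) * qp_coeff a (0, 0):]"
    if "a \<in> {z, w}" "b \<in> {z, w}" for a b
  proof -
    have act_1: "weyl_act c 1 = [:qp_coeff c (0, 0):]" if "c \<in> {z, w}" for c
      using that assms by (auto simp: weyl_act_one_nonpos)
    have "weyl_act b (weyl_act a 1) = weyl_act b (smult (qp_coeff a (0, 0)) 1)"
      using act_1[OF that(1)] by simp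
    also have "\<dots> = smult (qp_coeff a (0, 0)) (weyl_act b 1)"
      by (rule weyl_act_smult)
    finally show ?thesis
      using act_1[OF that(2)] by (simp add: mult.commute)
  qed
  ultimately show False
    by (simp add: commutator_def weyl_act_diff weyl_act_mult mult.commute)
qed

section \<open>Generation\<close>

lemma weyl_subalgebra_generated: "weyl_subalgebra (weyl_generated S)"
  unfolding weyl_generated_def
proof (rule hull_in)
  fix F :: "'a weyl set set"
  assume "\<forall>B\<in>F. weyl_subalgebra B"
  then show "weyl_subalgebra (\<Inter>F)"
    unfolding weyl_subalgebra_def using weyl.subspace_Inter[of F] by blast
qed

lemma weyl_subalgebra_power: "weyl_subalgebra B \<Longrightarrow> a \<in> B \<Longrightarrow> a ^ n \<in> B"
  by (induction n) (simp_all add: weyl_subalgebra_def)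

lemma weyl_subalgebra_eq_UNIV:
  assumes "weyl_subalgebra B" "weyl_p \<in> B" "weyl_q \<in> B"
  shows "B = UNIV"
  using assms unfolding weyl_subalgebra_def by (intro subspace_closed_under_gens_eq_UNIV) blast+

text \<open>
  A single monomial of an element can be isolated once all the others are available.
\<close>

lemma qp_mon_in_subspace:
  assumes B: "weyl.subspace B" "a \<in> B" and x: "x \<in> qp_supp a"
    and others: "\<And>y. y \<in> qp_supp a \<Longrightarrow> y \<noteq> x \<Longrightarrow> qp_mon y \<in> B"
  shows "qp_mon x \<in> B"
proof -
  let ?r = "\<Sum>y\<in>qp_supp a - {x}. qp_coeff a y *\<^sub>K qp_mon y"
  have "qp_coeff a x *\<^sub>K qp_mon x + ?r = a"
    by (rule trans[OF sum.remove[OF finite_qp_supp x, symmetric] qp_expansion[symmetric]])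
  then have "qp_coeff a x *\<^sub>K qp_mon x = a - ?r"
    by (simp only: eq_diff_eq)
  moreover have "?r \<in> B"
    using B(1) others by (intro weyl.subspace_sum weyl.subspace_scale) auto
  ultimately have "qp_coeff a x *\<^sub>K qp_mon x \<in> B"
    using weyl.subspace_diff[OF B] by simp
  then have "inverse (qp_coeff a x) *\<^sub>K qp_coeff a x *\<^sub>K qp_mon x \<in> B"
    by (rule weyl.subspace_scale[OF B(1)])
  then show ?thesis
    using x by (simp add: qp_supp_def)
qed

lemma qp_mon_0_left: "qp_mon (0, t) = weyl_q ^ t"
  and qp_mon_0_right: "qp_mon (j, 0) = weyl_p ^ j"
  by (simp_all add: qp_mon_pair)

lemma generated_eq_UNIV_of_cone:
  fixes z w :: "'k::field_char_0 weyl"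
  assumes zw: "commutator z w = 1"
    and cone: "(\<forall>(i, s)\<in>qp_supp z. i \<le> s) \<or> (\<forall>(i, s)\<in>qp_supp z. s \<le> i)"
  shows "weyl_generated {z, w} = UNIV"
proof -
  let ?B = "weyl_generated {z, w}"
  have B: "weyl_subalgebra ?B" "weyl.subspace ?B" "1 \<in> ?B" "z \<in> ?B" "w \<in> ?B"
    using weyl_subalgebra_generated[of "{z, w}"]
    by (auto simp: weyl_subalgebra_def weyl_generated_def hull_inc)
  \<comment> \<open>A constant term could be leading and is parallel to every exponent.\<close>
  define z' where "z' = z - qp_coeff z (0, 0) *\<^sub>K 1"
  define S where "S = qp_supp z - {(0, 0)}"
  define T where "T = qp_supp w"
  have supp: "qp_supp z' = S"
    by (auto simp: z'_def S_def qp_supp_def qp_coeff_diff qp_coeff_scale qp_coeff_one)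
  have "commutator z' w = 1"
    using zw by (simp add: z'_def commutator_def left_diff_distrib right_diff_distrib
        weyl_scale_mult_left weyl_scale_mult_right)
  then have ub: "unit_bracket S T"
    using unit_bracket_qp_supp[of z' w] by (simp add: supp T_def)
  have fin: "finite S" "finite T"
    by (simp_all add: S_def T_def finite_qp_supp)
  have "S \<noteq> {}"
  proof
    assume "S = {}"
    then have "z' = 0" using qp_expansion[of z'] by (simp add: supp)
    with \<open>commutator z' w = 1\<close> show False by (simp add: commutator_def)
  qed
  from cone show ?thesis
  proof
    assume nonneg: "\<forall>(i, s)\<in>qp_supp z. i \<le> s"
    have ex: "\<exists>(j, t)\<in>T. t < j"
    proof (rule ccontr)
      assume "\<not> ?thesis"
      then have "i \<le> s" if "(i, s) \<in> qp_supp w" for i s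
        using that by (fastforce simp: T_def)
      with nonneg zw commutator_neq_1_nonneg[of z w] show False by blast
    qed
    have S: "(0, 0) \<notin> S" "\<And>i s. (i, s) \<in> S \<Longrightarrow> i \<le> s"
      using nonneg by (auto simp: S_def)
    note shape = unit_bracket_shape[OF fin ub \<open>S \<noteq> {}\<close> S ex]
    have "qp_mon (0, 1) \<in> ?B"
    proof (rule qp_mon_in_subspace[OF B(2,4)])
      show "(0, 1) \<in> qp_supp z" using shape(1) unfolding S_def by blast
      fix y assume "y \<in> qp_supp z" "y \<noteq> (0, 1)"
      then have "y = (0, 0)" using shape(1) unfolding S_def by blast
      then show "qp_mon y \<in> ?B" using B(3) by (simp add: qp_mon_origin)
    qed
    then have q: "weyl_q \<in> ?B"
      by (simp add: qp_mon_0_left)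
    have "qp_mon (1, 0) \<in> ?B"
    proof (rule qp_mon_in_subspace[OF B(2,5)])
      show "(1, 0) \<in> qp_supp w" using shape(2) by (simp add: T_def)
      fix y assume "y \<in> qp_supp w" "y \<noteq> (1, 0)"
      then have "y \<in> range (Pair 0)" using shape(3) unfolding T_def by blast
      then show "qp_mon y \<in> ?B"
        using weyl_subalgebra_power[OF B(1) q] by (auto simp: qp_mon_0_left)
    qed
    then have "weyl_p \<in> ?B"
      by (simp add: qp_mon_0_right)
    with q show ?thesis by (intro weyl_subalgebra_eq_UNIV[OF B(1)])
  next
    assume nonpos: "\<forall>(i, s)\<in>qp_supp z. s \<le> i"
    let ?S = "prod.swap ` S" and ?T = "prod.swap ` T"
    have ex: "\<exists>(j, t)\<in>?T. t < j"
    proof (rule ccontr)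
      assume "\<not> ?thesis"
      then have "s \<le> i" if "(i, s) \<in> qp_supp w" for i s
        using that by (fastforce simp: T_def)
      with nonpos zw commutator_neq_1_nonpos[of z w] show False by blast
    qed
    have "finite ?S" "finite ?T" "?S \<noteq> {}" "(0, 0) \<notin> ?S" "\<And>i s. (i, s) \<in> ?S \<Longrightarrow> i \<le> s"
      using fin \<open>S \<noteq> {}\<close> nonpos by (auto simp: S_def)
    note swapped = unit_bracket_shape[OF this(1,2) unit_bracket_swap[OF ub] this(3-5) ex]
    have swap_swap: "prod.swap ` prod.swap ` A = A" for A :: "(nat \<times> nat) set"
      by (simp add: image_image)
    have "S = {(1, 0)}"
      using arg_cong[OF swapped(1), of "(`) prod.swap"] by (simp add: swap_swap)
    moreover have "(0, 1) \<in> T"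
      using imageI[OF swapped(2), of prod.swap] by (simp add: swap_swap)
    moreover have "T \<subseteq> insert (0, 1) (range (\<lambda>j. (j, 0)))"
      using image_mono[OF swapped(3), of prod.swap] by (simp add: swap_swap image_image)
    ultimately have shape: "S = {(1, 0)}" "(0, 1) \<in> T" "T \<subseteq> insert (0, 1) (range (\<lambda>j. (j, 0)))"
      by this+
    have "qp_mon (1, 0) \<in> ?B"
    proof (rule qp_mon_in_subspace[OF B(2,4)])
      show "(1, 0) \<in> qp_supp z" using shape(1) unfolding S_def by blast
      fix y assume "y \<in> qp_supp z" "y \<noteq> (1, 0)"
      then have "y = (0, 0)" using shape(1) unfolding S_def by blast
      then show "qp_mon y \<in> ?B" using B(3) by (simp add: qp_mon_origin)
    qed
    then have p: "weyl_p \<in> ?B"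
      by (simp add: qp_mon_0_right)
    have "qp_mon (0, 1) \<in> ?B"
    proof (rule qp_mon_in_subspace[OF B(2,5)])
      show "(0, 1) \<in> qp_supp w" using shape(2) by (simp add: T_def)
      fix y assume "y \<in> qp_supp w" "y \<noteq> (0, 1)"
      then have "y \<in> range (\<lambda>j. (j, 0))" using shape(3) unfolding T_def by blast
      then show "qp_mon y \<in> ?B"
        using weyl_subalgebra_power[OF B(1) p] by (auto simp: qp_mon_0_right)
    qed
    then have "weyl_q \<in> ?B"
      by (simp add: qp_mon_0_left)
    with p show ?thesis by (intro weyl_subalgebra_eq_UNIV[OF B(1)])
  qed
qed

text \<open>
  The image under \<open>\<psi>\<close> of the subalgebra generated by \<open>S\<close> is a subalgebra that contains \<open>\<psi> ` S\<close>,
  hence everything; as \<open>\<psi>\<close> is injective, the original subalgebra was already everything.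
\<close>

lemma generated_eq_UNIV_if_automorphism:
  assumes aut: "weyl_automorphism \<psi>" and UNIV: "weyl_generated (\<psi> ` S) = UNIV"
  shows "weyl_generated S = UNIV"
proof -
  interpret lin: Vector_Spaces.linear weyl_scale weyl_scale \<psi>
    using aut by (simp add: weyl_automorphism_def)
  have \<psi>: "inj \<psi>" "\<psi> 1 = 1" "\<And>x y. \<psi> (x * y) = \<psi> x * \<psi> y"
    using aut by (auto simp: weyl_automorphism_def bij_is_inj)
  note sub = weyl_subalgebra_generated[of S, unfolded weyl_subalgebra_def]
  have "weyl_subalgebra (\<psi> ` weyl_generated S)"
    unfolding weyl_subalgebra_def
  proof (intro conjI ballI)
    show "weyl.subspace (\<psi> ` weyl_generated S)"
      using sub by (intro lin.subspace_image) simp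
    show "1 \<in> \<psi> ` weyl_generated S"
      using sub \<psi>(2) by (metis imageI)
    show "x * y \<in> \<psi> ` weyl_generated S"
      if "x \<in> \<psi> ` weyl_generated S" "y \<in> \<psi> ` weyl_generated S" for x y
      using that sub by (auto simp flip: \<psi>(3))
  qed
  moreover have "\<psi> ` S \<subseteq> \<psi> ` weyl_generated S"
    by (intro image_mono) (simp add: weyl_generated_def hull_subset)
  ultimately have "weyl_generated (\<psi> ` S) \<subseteq> \<psi> ` weyl_generated S"
    unfolding weyl_generated_def[of "\<psi> ` S"] by (intro hull_minimal)
  then have "\<psi> ` weyl_generated S = \<psi> ` UNIV"
    using UNIV by auto
  then show ?thesis
    using \<psi>(1) by (simp add: inj_image_eq_iff)
qed

theorem theorem3p7:
  fixes z w :: "'k::field_char_0 weyl"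
  assumes "commutator z w = 1"
    and "(\<exists>d\<in>weyl_D_nonneg. weyl_conjugate z d) \<or> (\<exists>d\<in>weyl_D_nonpos. weyl_conjugate z d)"
  shows "weyl_generated {z, w} = UNIV"
proof -
  obtain \<psi> where aut: "weyl_automorphism \<psi>"
    and graded: "\<psi> z \<in> weyl_D_nonneg \<or> \<psi> z \<in> weyl_D_nonpos"
    using assms(2) by (auto simp: weyl_conjugate_def)
  interpret lin: Vector_Spaces.linear weyl_scale weyl_scale \<psi>
    using aut by (simp add: weyl_automorphism_def)
  have "commutator (\<psi> z) (\<psi> w) = \<psi> (commutator z w)"
    using aut by (simp add: weyl_automorphism_def commutator_def lin.diff)
  then have "commutator (\<psi> z) (\<psi> w) = 1"
    using aut assms(1) by (simp add: weyl_automorphism_def)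
  moreover have "(\<forall>(i, s)\<in>qp_supp (\<psi> z). i \<le> s) \<or> (\<forall>(i, s)\<in>qp_supp (\<psi> z). s \<le> i)"
    using graded qp_supp_D_nonneg qp_supp_D_nonpos by blast
  ultimately have "weyl_generated {\<psi> z, \<psi> w} = UNIV"
    by (rule generated_eq_UNIV_of_cone)
  then show ?thesis
    using generated_eq_UNIV_if_automorphism[OF aut, of "{z, w}"] by simp
qed

end
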